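(* Consider a generalized alpha investing rule (with parameters $w_0\ge0$, $b_0>0$) and an index sequence $\mathcal{I}=(\mathcal{I}_i)_{i\ge0}$ such that, for each $j\in\mathbb{N}$, there is a function $g_j:[0,\infty)\to[0,1]$ with $$\alpha_j(R_1,\dots,R_{j-1})=g_j\big(\mathcal{I}_{j-1}(R_1,\dots,R_{j-1})\big).$$ Assume that each $g_j$ is nondecreasing and weakly differentiable, with weak derivative $\dot g_j$. Then, for arbitrary dependencies among the $p$-values, for every $n\ge1$, $$\mathrm{FDR}(n)\le\sum_{i=1}^n\bigg\{g_i\big(\mathcal{I}_{\min}(i-1)\big)+\int_{\mathcal{I}_{\min}(i-1)}^{\mathcal{I}_{\max}(i-1)}\frac{\dot g_i(s)}{R^{\mathrm L}_i(s)+1}\,\mathrm{d}s\bigg\}.$$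
   Context: Setting. $\mathbb{N}=\{1,2,\dots\}$. There is a sequence of null hypotheses $(H_i)_{i\in\mathbb{N}}$ with $H_i=\{\theta_i=0\}$, where $\theta_i$ belongs to a set $\Theta$ of possible parameter values and $\boldsymbol\theta=(\theta_i)_{i\in\mathbb{N}}\in\boldsymbol\Theta=\Theta^{\mathbb{N}}$. For each $\boldsymbol\theta$, $\mathbb{P}_{\boldsymbol\theta}$ (expectation $\mathbb{E}_{\boldsymbol\theta}$) is the joint law of the $[0,1]$-valued $p$-values $(p_i)_{i\in\mathbb{N}}$; if $\theta_i=0$ (true null) then $p_i$ is uniform on $[0,1]$ under $\mathbb{P}_{\boldsymbol\theta}$. No assumption is made on the joint dependence. Generalized alpha investing rule. A generalized alpha investing rule with parameters $w_0\ge0$, $b_0>0$ is given by functions $\alpha_j,\varphi_j,\psi_j:\{0,1\}^{j-1}\to[0,\infty)$, $j\in\mathbb{N}$. Decisions are $R_j=1$ (reject $H_j$) if $p_j\le\alpha_j(R_1,\dots,R_{j-1})$ and $R_j=0$ otherwise. The potential is $W(0)=w_0$, $W(j)=W(j-1)-\varphi_j(R_1,\dots,R_{j-1})+R_j\,\psi_j(R_1,\dots,R_{j-1})$, viewed as a function of $(R_1,\dots,R_j)\in\{0,1\}^j$. It is required that, for all $j\in\mathbb{N}$ and all $(R_1,\dots,R_{j-1})\in\{0,1\}^{j-1}$ (evaluating $\alpha_j,\varphi_j,\psi_j$ at this history): (G1) $\psi_j\le\varphi_j+b_0$; $\ \psi_j\le \varphi_j/\alpha_j+b_0-1$ (with $\varphi_j/\alpha_j:=+\infty$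 when $\alpha_j=0$); and $\varphi_j\le W(j-1)$. (G2) if $W(j-1)=0$ then $\alpha_j=0$. FDR. $R(n)=\sum_{i=1}^n R_i$, $V^{\boldsymbol\theta}(n)=\#\{i\le n: R_i=1,\ \theta_i=0\}$, and $\mathrm{FDR}(n)=\sup_{\boldsymbol\theta\in\boldsymbol\Theta}\mathbb{E}_{\boldsymbol\theta}\big[V^{\boldsymbol\theta}(n)/\max(R(n),1)\big]$. Index sequences. An index sequence is a sequence of deterministic functions $\mathcal{I}_i:\{0,1\}^i\to[0,\infty)$, $i\ge0$ ($\mathcal{I}_0$ is a constant). Let $\mathcal{R}_i\subseteq\{0,1\}^i$ be the set of decision sequences $(r_1,\dots,r_i)$ with nonzero probability, i.e. $\mathbb{P}_{\boldsymbol\theta}((R_1,\dots,R_i)=(r_1,\dots,r_i))>0$ for some $\boldsymbol\theta\in\boldsymbol\Theta$ ($\mathcal{R}_0$ consists of the empty sequence). Define $$\mathcal{I}_{\min}(i)=\min_{\boldsymbol r\in\mathcal{R}_i}\mathcal{I}_i(\boldsymbol r),\qquad \mathcal{I}_{\max}(i)=\max_{\boldsymbol r\in\mathcal{R}_i}\mathcal{I}_i(\boldsymbol r),$$ $$R^{\mathrm L}_i(s)=\min\Big\{\sum_{j=1}^{i-1}r_j:\ (r_1,\dots,r_{i-1})\in\mathcal{R}_{i-1},\ \mathcal{I}_{i-1}(r_1,\dots,r_{i-1})\ge s\Big\}.$$ "Weakly differentiable" means that $g_j$ is locally absolutely continuous on $[0,\infty)$, with almost-everywhere derivative $\dot g_j$.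 *)

theory Defs
  imports "HOL-Probability.Probability"
begin

text \<open>
  Hypotheses are indexed by the positive integers.  A decision sequence
  \<open>(r\<^sub>1, \<dots>, r\<^sub>i)\<close> in \<open>{0,1}\<^sup>i\<close> is a \<^typ>\<open>bool list\<close> of length \<open>i\<close>
  (so \<open>r\<^sub>j\<close> is \<open>r ! (j - 1)\<close>), and a function on \<open>{0,1}\<^sup>j\<^sup>-\<^sup>1\<close> attached to
  hypothesis \<open>j\<close> is a function of \<open>j\<close> and a list whose value matters only when the
  list has length \<open>j - 1\<close>.
\<close>

definition parameters :: "'t set \<Rightarrow> (nat \<Rightarrow> 't) set" where
  "parameters \<Theta> = {1..} \<rightarrow>\<^sub>E \<Theta>"

text \<open>
  The \<open>p\<close>-values are random variables on a probability space with measure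
  \<open>P \<theta>\<close>; taking them to be the coordinate projections makes \<open>P \<theta>\<close> their
  joint law.  Nothing is assumed about their joint dependence.
\<close>

locale testing_model =
  fixes \<Theta> :: "'t::zero set"
    and P :: "(nat \<Rightarrow> 't) \<Rightarrow> 'w measure"
    and p :: "nat \<Rightarrow> 'w \<Rightarrow> real"
  assumes Theta_nonempty: "\<Theta> \<noteq> {}"
    and prob_space: "\<And>\<theta>. \<theta> \<in> parameters \<Theta> \<Longrightarrow> prob_space (P \<theta>)"
    and pvalue_measurable:
      "\<And>\<theta> i. \<theta> \<in> parameters \<Theta> \<Longrightarrow> i \<ge> 1 \<Longrightarrow> p i \<in> borel_measurable (P \<theta>)"
    and pvalue_range:
      "\<And>\<theta> i \<omega>. \<theta> \<in> parameters \<Theta> \<Longrightarrow> i \<ge> 1 \<Longrightarrow> \<omega> \<in> space (P \<theta>) \<Longrightarrow> p i \<omega> \<in> {0..1}"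
    and null_uniform:
      "\<And>\<theta> i. \<theta> \<in> parameters \<Theta> \<Longrightarrow> i \<ge> 1 \<Longrightarrow> \<theta> i = 0 \<Longrightarrow>
         distr (P \<theta>) borel (p i) = uniform_measure lborel {0..1}"

primrec potential ::
  "real \<Rightarrow> (nat \<Rightarrow> bool list \<Rightarrow> real) \<Rightarrow> (nat \<Rightarrow> bool list \<Rightarrow> real) \<Rightarrow> bool list \<Rightarrow> nat \<Rightarrow> real" where
  "potential w\<^sub>0 \<phi> \<psi> r 0 = w\<^sub>0"
| "potential w\<^sub>0 \<phi> \<psi> r (Suc k) =
     potential w\<^sub>0 \<phi> \<psi> r k - \<phi> (Suc k) (take k r) + of_bool (r ! k) * \<psi> (Suc k) (take k r)"

locale generalized_alpha_investing =
  fixes w\<^sub>0 b\<^sub>0 :: real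
    and \<alpha> \<phi> \<psi> :: "nat \<Rightarrow> bool list \<Rightarrow> real"
  assumes w0_nonneg: "w\<^sub>0 \<ge> 0"
    and b0_pos: "b\<^sub>0 > 0"
    and nonneg: "\<And>j r. j \<ge> 1 \<Longrightarrow> length r = j - 1 \<Longrightarrow> \<alpha> j r \<ge> 0 \<and> \<phi> j r \<ge> 0 \<and> \<psi> j r \<ge> 0"
    and G1: "\<And>j r. j \<ge> 1 \<Longrightarrow> length r = j - 1 \<Longrightarrow>
      \<psi> j r \<le> \<phi> j r + b\<^sub>0 \<and>
      (\<alpha> j r \<noteq> 0 \<longrightarrow> \<psi> j r \<le> \<phi> j r / \<alpha> j r + b\<^sub>0 - 1) \<and>
      \<phi> j r \<le> potential w\<^sub>0 \<phi> \<psi> r (j - 1)"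
    and G2: "\<And>j r. j \<ge> 1 \<Longrightarrow> length r = j - 1 \<Longrightarrow>
      potential w\<^sub>0 \<phi> \<psi> r (j - 1) = 0 \<Longrightarrow> \<alpha> j r = 0"

primrec decisions :: "(nat \<Rightarrow> bool list \<Rightarrow> real) \<Rightarrow> (nat \<Rightarrow> real) \<Rightarrow> nat \<Rightarrow> bool list" where
  "decisions \<alpha> x 0 = []"
| "decisions \<alpha> x (Suc k) =
     decisions \<alpha> x k @ [x (Suc k) \<le> \<alpha> (Suc k) (decisions \<alpha> x k)]"

definition rejections :: "bool list \<Rightarrow> nat" where
  "rejections r = (\<Sum>k<length r. of_bool (r ! k))"

definition false_rejections :: "(nat \<Rightarrow> 't::zero) \<Rightarrow> bool list \<Rightarrow> nat" where
  "false_rejections \<theta> r = card {i \<in> {1..length r}. r ! (i - 1) \<and> \<theta> i = 0}"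

definition FDR ::
  "'t::zero set \<Rightarrow> ((nat \<Rightarrow> 't) \<Rightarrow> 'w measure) \<Rightarrow> (nat \<Rightarrow> 'w \<Rightarrow> real)
    \<Rightarrow> (nat \<Rightarrow> bool list \<Rightarrow> real) \<Rightarrow> nat \<Rightarrow> real" where
  "FDR \<Theta> P p \<alpha> n =
     (SUP \<theta>\<in>parameters \<Theta>. LINT \<omega>|P \<theta>.
        (let r = decisions \<alpha> (\<lambda>i. p i \<omega>) n
         in real (false_rejections \<theta> r) / real (max (rejections r) 1)))"

definition reachable ::
  "'t set \<Rightarrow> ((nat \<Rightarrow> 't) \<Rightarrow> 'w measure) \<Rightarrow> (nat \<Rightarrow> 'w \<Rightarrow> real)
    \<Rightarrow> (nat \<Rightarrow> bool list \<Rightarrow> real) \<Rightarrow> nat \<Rightarrow> bool list set" where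
  "reachable \<Theta> P p \<alpha> i =
     {r. length r = i \<and> (\<exists>\<theta>\<in>parameters \<Theta>.
           measure (P \<theta>) {\<omega> \<in> space (P \<theta>). decisions \<alpha> (\<lambda>i. p i \<omega>) i = r} > 0)}"

definition I_min :: "(nat \<Rightarrow> bool list set) \<Rightarrow> (nat \<Rightarrow> bool list \<Rightarrow> real) \<Rightarrow> nat \<Rightarrow> real" where
  "I_min \<R> \<I> i = Min (\<I> i ` \<R> i)"

definition I_max :: "(nat \<Rightarrow> bool list set) \<Rightarrow> (nat \<Rightarrow> bool list \<Rightarrow> real) \<Rightarrow> nat \<Rightarrow> real" where
  "I_max \<R> \<I> i = Max (\<I> i ` \<R> i)"

text \<open>
  Below, the minimum is over a nonempty set exactly for \<open>s \<le> I_max \<R> \<I> (i - 1)\<close>;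
  only such \<open>s\<close> are ever used.
\<close>

definition R_L ::
  "(nat \<Rightarrow> bool list set) \<Rightarrow> (nat \<Rightarrow> bool list \<Rightarrow> real) \<Rightarrow> nat \<Rightarrow> real \<Rightarrow> nat" where
  "R_L \<R> \<I> i s = Min (rejections ` {r \<in> \<R> (i - 1). \<I> (i - 1) r \<ge> s})"

text \<open>
  The classical \<open>\<epsilon>\<close>-\<open>\<delta>\<close> definition, with the finite families of nonoverlapping
  compact subintervals of \<open>[a,b]\<close> expressed by \<^const>\<open>division_of\<close>.
\<close>

definition absolutely_continuous_on_interval :: "(real \<Rightarrow> real) \<Rightarrow> real \<Rightarrow> real \<Rightarrow> bool" where
  "absolutely_continuous_on_interval g a b \<longleftrightarrow>
     (\<forall>\<epsilon>>0. \<exists>\<delta>>0. \<forall>\<D> T. \<D> division_of T \<longrightarrow> T \<subseteq> {a..b} \<longrightarrow>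
        (\<Sum>K\<in>\<D>. Sup K - Inf K) < \<delta> \<longrightarrow> (\<Sum>K\<in>\<D>. \<bar>g (Sup K) - g (Inf K)\<bar>) < \<epsilon>)"

text \<open>
  A weak derivative is determined only up to null sets and need not be Borel measurable,
  hence \<^const>\<open>lebesgue\<close> rather than \<^const>\<open>lborel\<close> here and in integrals of \<open>g'\<close>.
\<close>

definition weakly_differentiable_on_nonneg ::
  "(real \<Rightarrow> real) \<Rightarrow> (real \<Rightarrow> real) \<Rightarrow> bool" where
  "weakly_differentiable_on_nonneg g g' \<longleftrightarrow>
     (\<forall>a b. 0 \<le> a \<longrightarrow> a \<le> b \<longrightarrow> absolutely_continuous_on_interval g a b) \<and>
     (AE s in lebesgue. 0 \<le> s \<longrightarrow> (g has_real_derivative g' s) (at s within {0..}))"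

end

theory Submission
  imports Defs
begin

text \<open>
  A rejection of \<open>H\<^sub>i\<close> enters the false discovery proportion at time \<open>n\<close> with weight at most
  \<open>1 / (R(i - 1) + 1)\<close>, because the total number of rejections is at least the number made
  before time \<open>i\<close> plus the rejection of \<open>H\<^sub>i\<close> itself.  So it suffices to bound, for every true
  null \<open>H\<^sub>i\<close>, the expectation of \<open>1{p\<^sub>i \<le> g\<^sub>i(X)} / (R(i - 1) + 1)\<close>, where \<open>X\<close> is the random
  index value seen at time \<open>i\<close>.

  Here \<open>X\<close> and \<open>p\<^sub>i\<close> may depend on each other in any way, so the bound has to be pathwise.
  Almost surely the history is reachable, and then \<open>R(i - 1) \<ge> R\<^sup>L\<^sub>i(X)\<close>; the weight is thus at
  most \<open>h(X)\<close> with \<open>h = 1 / (R\<^sup>L\<^sub>i + 1)\<close>, which is a decreasing function.  The threshold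
  \<open>g\<^sub>i(X)\<close> is increasing in \<open>X\<close>, the weight \<open>h(X)\<close> decreasing.  Hence, whatever \<open>X\<close> is, a
  \<open>p\<close>-value \<open>u\<close> is worth at most \<open>h(x(u))\<close>, where \<open>x(u)\<close> is the smallest possible index value
  whose threshold admits \<open>u\<close>.  This majorant is a function of \<open>p\<^sub>i\<close> alone, so uniformity of
  \<open>p\<^sub>i\<close> gives its expectation: at most \<open>g\<^sub>i(I_min)\<close> from \<open>u \<le> g\<^sub>i(I_min)\<close>, plus the
  Riemann-Stieltjes sum of \<open>h\<close> against the increments of \<open>g\<^sub>i\<close> over the finitely many index
  values (\<open>expectation_weighted_threshold_le\<close>).

  As \<open>h\<close> is decreasing, evaluating it at right end points makes that sum a lower sum for
  \<open>\<integral> g\<^sub>i' h\<close> (\<open>weighted_increments_le_integral\<close>).  This last comparison needs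
  \<open>\<integral>\<^sub>u\<^sup>v g\<^sub>i' = g\<^sub>i(v) - g\<^sub>i(u)\<close>, with equality rather than the inequality \<open>\<le>\<close> valid for every
  monotone function; it is the fundamental theorem of calculus for absolutely continuous
  functions (\<open>has_integral_absolutely_continuous\<close>).
\<close>

section \<open>Absolutely continuous functions\<close>

text \<open>
  This is proved with the gauge integral, redefining the derivative to be \<open>0\<close> on the
  exceptional set \<open>N\<close>.  A cell tagged outside \<open>N\<close> is handled by differentiability at its
  tag, as for everywhere differentiable functions.  The cells tagged in \<open>N\<close> contribute only
  the increments of \<open>f\<close>; the gauge keeps these cells inside an open set of small measure
  around \<open>N\<close>, so their increments have small sum by absolute continuity.
\<close>

lemma has_integral_absolutely_continuous:
  fixes f f' :: "real \<Rightarrow> real"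
  assumes "a \<le> b"
    and ac: "absolutely_continuous_on_interval f a b"
    and N: "negligible N"
    and deriv: "\<And>x. x \<in> {a..b} - N \<Longrightarrow> (f has_real_derivative f' x) (at x within {a..b})"
  shows "(f' has_integral (f b - f a)) {a..b}"
proof (rule has_integral_spike[OF N])
  let ?F = "\<lambda>x. if x \<in> N then 0 else f' x"
  let ?\<Delta> = "\<lambda>K. f (Sup K) - f (Inf K)"
  show "f' x = ?F x" if "x \<in> {a..b} - N" for x
    using that by simp
  show "(?F has_integral (f b - f a)) {a..b}"
    unfolding has_integral_real
  proof (intro allI impI)
    fix \<epsilon> :: real
    assume "\<epsilon> > 0"
    \<comment> \<open>Half of \<open>\<epsilon>\<close> is for the cells tagged outside \<open>N\<close>, half for those tagged in \<open>N\<close>;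
        the \<open>+ 1\<close> admits the degenerate interval.\<close>
    define \<eta> where "\<eta> = \<epsilon> / (2 * (b - a + 1))"
    have "\<eta> > 0" and \<eta>: "\<eta> * (b - a) < \<epsilon> / 2"
      using \<open>\<epsilon> > 0\<close> \<open>a \<le> b\<close> by (auto simp: \<eta>_def field_simps)
    obtain \<delta> where "\<delta> > 0" and \<delta>: "\<And>\<D> T. \<lbrakk>\<D> division_of T; T \<subseteq> {a..b};
        (\<Sum>K\<in>\<D>. Sup K - Inf K) < \<delta>\<rbrakk> \<Longrightarrow> (\<Sum>K\<in>\<D>. \<bar>?\<Delta> K\<bar>) < \<epsilon> / 2"
      using ac \<open>\<epsilon> > 0\<close> unfolding absolutely_continuous_on_interval_def
      by (meson half_gt_zero)
    obtain U where "open U" "N \<subseteq> U" and U: "U \<in> lmeasurable" "measure lebesgue U < \<delta>"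
    proof -
      have "N \<in> null_sets lebesgue"
        using N negligible_iff_null_sets by blast
      then obtain U where U: "open U" "N \<subseteq> U" "U - N \<in> lmeasurable"
        "emeasure lebesgue (U - N) < ennreal \<delta>"
        using sets_lebesgue_outer_open[of N \<delta>] \<open>\<delta> > 0\<close> by blast
      have "U = (U - N) \<union> N"
        using U by blast
      then have "U \<in> lmeasurable" "emeasure lebesgue U = emeasure lebesgue (U - N)"
        using U \<open>N \<in> null_sets lebesgue\<close>
        by (metis N fmeasurable.Un negligible_imp_measurable,
            metis emeasure_Un_null_set fmeasurableD)
      then show ?thesis
        using U that[of U] \<open>\<delta> > 0\<close>
        by (metis emeasure_eq_measure2 ennreal_less_iff measure_nonneg)
    qed
    have "\<exists>r>0. (x \<in> N \<longrightarrow> ball x r \<subseteq> U) \<and>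
        (x \<in> {a..b} - N \<longrightarrow> (\<forall>y\<in>{a..b}. \<bar>y - x\<bar> < r \<longrightarrow>
           \<bar>f y - f x - (y - x) * f' x\<bar> \<le> \<eta> * \<bar>y - x\<bar>))" for x
    proof (cases "x \<in> N")
      case True
      then show ?thesis
        using \<open>open U\<close> \<open>N \<subseteq> U\<close> by (metis DiffD2 open_contains_ball subsetD)
    next
      case False
      show ?thesis
      proof (cases "x \<in> {a..b}")
        case True
        then have "(f has_derivative (\<lambda>h. h * f' x)) (at x within {a..b})"
          using deriv[of x] False
          by (simp add: has_field_derivative_def mult_commute_abs)
        then show ?thesis
          using \<open>\<eta> > 0\<close> False unfolding has_derivative_within_alt by fastforce
      qed (use False in \<open>auto intro: exI[of _ 1]\<close>)
    qed
    then obtain r where r: "\<And>x. r x > 0" "\<And>x. x \<in> N \<Longrightarrow> ball x (r x) \<subseteq> U"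
      "\<And>x y. \<lbrakk>x \<in> {a..b} - N; y \<in> {a..b}; \<bar>y - x\<bar> < r x\<rbrakk> \<Longrightarrow>
           \<bar>f y - f x - (y - x) * f' x\<bar> \<le> \<eta> * \<bar>y - x\<bar>"
      by metis
    show "\<exists>\<gamma>. gauge \<gamma> \<and> (\<forall>\<D>. \<D> tagged_division_of {a..b} \<and> \<gamma> fine \<D> \<longrightarrow>
        norm ((\<Sum>(x, K)\<in>\<D>. measure lborel K *\<^sub>R ?F x) - (f b - f a)) < \<epsilon>)"
    proof (intro exI conjI allI impI; (elim conjE)?)
      show "gauge (\<lambda>x. ball x (r x))"
        using r(1) gauge_ball_dependent by blast
    next
      fix \<D>
      assume tag: "\<D> tagged_division_of {a..b}" and fine: "(\<lambda>x. ball x (r x)) fine \<D>"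
      define Q where "Q = {(x, K) \<in> \<D>. x \<in> N}"
      have "finite \<D>"
        using tag by blast
      have cell: "\<exists>u v. K = {u..v} \<and> u \<le> v \<and> x \<in> {u..v} \<and> a \<le> u \<and> v \<le> b \<and> {u..v} \<subseteq> ball x (r x)"
        if xK: "(x, K) \<in> \<D>" for x K
      proof -
        obtain u v where K: "K = cbox u v"
          using tagged_division_ofD(4)[OF tag xK] by blast
        moreover have "x \<in> K" "K \<subseteq> {a..b}"
          using tagged_division_ofD(2,3)[OF tag xK] by auto
        moreover have "K \<subseteq> ball x (r x)"
          using fine xK by (auto simp: fine_def)
        ultimately show ?thesis
          by (intro exI[of _ u] exI[of _ v]) auto
      qed
      \<comment> \<open>Cells with different tags do not overlap, even if they are equal as sets, so a cell
          with two tags would have empty interior while containing two points.\<close>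
      have "inj_on snd Q"
      proof (intro inj_onI, clarsimp simp: Q_def)
        fix x y K
        assume xy: "(x, K) \<in> \<D>" "(y, K) \<in> \<D>"
        show "x = y"
        proof (rule ccontr)
          assume "x \<noteq> y"
          then have "interior K = {}"
            using tagged_division_ofD(5)[OF tag xy] by simp
          then show False
            using cell[OF xy(1)] cell[OF xy(2)] \<open>x \<noteq> y\<close> by auto
        qed
      qed
      have divQ: "snd ` Q division_of \<Union>(snd ` Q)"
        by (rule partial_division_of_tagged_division[where i = "{a..b}"],
            rule tagged_partial_division_subset[where s = \<D>])
          (use tag in \<open>auto simp: Q_def tagged_division_of_def\<close>)
      have "(\<Sum>K\<in>snd ` Q. Sup K - Inf K) = (\<Sum>K\<in>snd ` Q. measure lebesgue K)"
      proof (rule sum.cong[OF refl])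
        fix K
        assume "K \<in> snd ` Q"
        then obtain x where "(x, K) \<in> \<D>"
          by (auto simp: Q_def)
        with cell obtain u v where "K = {u..v}" "u \<le> v"
          by blast
        then show "Sup K - Inf K = measure lebesgue K"
          by simp
      qed
      also have "\<dots> = measure lebesgue (\<Union>(snd ` Q))"
        by (rule content_division[OF divQ])
      also have "\<dots> \<le> measure lebesgue U"
      proof (rule measure_mono_fmeasurable)
        show "\<Union>(snd ` Q) \<subseteq> U"
          using cell r(2) by (fastforce simp: Q_def)
      qed (use lmeasurable_division[OF divQ] U in auto)
      finally have "(\<Sum>K\<in>snd ` Q. Sup K - Inf K) < \<delta>"
        using U by simp
      moreover have "\<Union>(snd ` Q) \<subseteq> {a..b}"
        using cell by (fastforce simp: Q_def)
      ultimately have "(\<Sum>K\<in>snd ` Q. \<bar>?\<Delta> K\<bar>) < \<epsilon> / 2"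
        using \<delta> divQ by blast
      then have Q_small: "(\<Sum>(x, K)\<in>Q. \<bar>?\<Delta> K\<bar>) < \<epsilon> / 2"
        by (simp add: sum.reindex[OF \<open>inj_on snd Q\<close>] split_def)
      have len: "(\<Sum>(x, K)\<in>\<D>. Sup K - Inf K) = b - a"
        and var: "(\<Sum>(x, K)\<in>\<D>. ?\<Delta> K) = f b - f a"
        using additive_tagged_division_1[OF \<open>a \<le> b\<close> tag, of "\<lambda>x. x"]
          additive_tagged_division_1[OF \<open>a \<le> b\<close> tag, of f] by auto
      have local_bound: "\<bar>measure lborel K * ?F x - ?\<Delta> K\<bar> \<le> \<eta> * (Sup K - Inf K) + (if x \<in> N then \<bar>?\<Delta> K\<bar> else 0)"
        if xK: "(x, K) \<in> \<D>" for x K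
      proof -
        obtain u v where K: "K = {u..v}" "u \<le> v" "x \<in> {u..v}" "a \<le> u" "v \<le> b" "{u..v} \<subseteq> ball x (r x)"
          using cell[OF xK] by blast
        show ?thesis
        proof (cases "x \<in> N")
          case True
          then show ?thesis
            using K \<open>\<eta> > 0\<close> by (simp add: abs_minus_commute)
        next
          case False
          have "u \<in> ball x (r x)" "v \<in> ball x (r x)"
            using subsetD[OF K(6), of u] subsetD[OF K(6), of v] K(2) by simp_all
          then have "\<bar>f u - f x - (u - x) * f' x\<bar> \<le> \<eta> * \<bar>u - x\<bar>"
            "\<bar>f v - f x - (v - x) * f' x\<bar> \<le> \<eta> * \<bar>v - x\<bar>"
            using r(3)[of x u] r(3)[of x v] K False by (auto simp: dist_real_def)
          moreover have "\<eta> * \<bar>u - x\<bar> + \<eta> * \<bar>v - x\<bar> = \<eta> * (v - u)"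
            using K by (auto simp: algebra_simps abs_if)
          moreover have "(v - u) * f' x - (f v - f u) =
              (f u - f x - (u - x) * f' x) - (f v - f x - (v - x) * f' x)"
            by (simp add: algebra_simps)
          ultimately have "\<bar>(v - u) * f' x - (f v - f u)\<bar> \<le> \<eta> * (v - u)"
            by linarith
          then show ?thesis
            using K False by simp
        qed
      qed
      have "\<bar>(\<Sum>(x, K)\<in>\<D>. measure lborel K * ?F x) - (f b - f a)\<bar>
          = \<bar>\<Sum>(x, K)\<in>\<D>. measure lborel K * ?F x - ?\<Delta> K\<bar>"
        by (simp add: var[symmetric] split_def sum_subtractf)
      also have "\<dots> \<le> (\<Sum>(x, K)\<in>\<D>. \<bar>measure lborel K * ?F x - ?\<Delta> K\<bar>)"
        unfolding split_def by (rule sum_abs)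
      also have "\<dots> \<le> (\<Sum>(x, K)\<in>\<D>. \<eta> * (Sup K - Inf K) + (if x \<in> N then \<bar>?\<Delta> K\<bar> else 0))"
        using local_bound by (intro sum_mono) auto
      also have "\<dots> = \<eta> * (b - a) + (\<Sum>(x, K)\<in>\<D>. if x \<in> N then \<bar>?\<Delta> K\<bar> else 0)"
        by (simp add: len[symmetric] split_def sum.distrib sum_distrib_left)
      also have "(\<Sum>(x, K)\<in>\<D>. if x \<in> N then \<bar>?\<Delta> K\<bar> else 0) = (\<Sum>(x, K)\<in>Q. \<bar>?\<Delta> K\<bar>)"
        unfolding Q_def using \<open>finite \<D>\<close>
        by (auto simp: split_def sum.inter_filter intro!: sum.cong)
      also have "\<eta> * (b - a) + \<dots> < \<epsilon>"
        using \<eta> Q_small by linarith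
      finally show "norm ((\<Sum>(x, K)\<in>\<D>. measure lborel K *\<^sub>R ?F x) - (f b - f a)) < \<epsilon>"
        by simp
    qed
  qed
qed

text \<open>
  For a monotone function the weak derivative is nonnegative almost everywhere, which upgrades
  gauge integrability to Lebesgue integrability.
\<close>

lemma weak_derivative_of_monotone:
  assumes wd: "weakly_differentiable_on_nonneg g g'"
    and mono: "mono_on {0..} g"
    and "0 \<le> a" "a \<le> b"
  shows weak_derivative_set_integrable: "set_integrable lebesgue {a..b} g'"
    and weak_derivative_integral: "(LINT s:{a..b}|lebesgue. g' s) = g b - g a"
    and weak_derivative_nonneg: "AE s in lebesgue. s \<in> {a..b} \<longrightarrow> 0 \<le> g' s"
proof -
  have "AE s in lebesgue. 0 \<le> s \<longrightarrow> (g has_real_derivative g' s) (at s within {0..})"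
    using wd by (simp add: weakly_differentiable_on_nonneg_def)
  then obtain N\<^sub>0 where N\<^sub>0: "negligible N\<^sub>0"
    and deriv: "\<And>s. s \<notin> N\<^sub>0 \<Longrightarrow> 0 \<le> s \<Longrightarrow> (g has_real_derivative g' s) (at s within {0..})"
    unfolding eventually_ae_filter negligible_iff_null_sets by (auto simp: subset_iff)
  \<comment> \<open>The sign of the derivative is read off at interior points of the half-line.\<close>
  define N where "N = insert 0 N\<^sub>0"
  have "negligible N"
    using N\<^sub>0 by (simp add: N_def)
  have nonneg: "0 \<le> g' s" if "s \<in> {a..b} - N" for s
  proof -
    have "s > 0"
      using that \<open>0 \<le> a\<close> by (auto simp: N_def)
    then have s: "s \<in> interior {0..}"
      by simp
    have "(g has_real_derivative g' s) (at s)"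
      using deriv[of s] that \<open>s > 0\<close> at_within_interior[OF s] by (auto simp: N_def)
    then show ?thesis
      using mono_on_imp_deriv_nonneg[OF mono _ s] by blast
  qed
  have int: "(g' has_integral (g b - g a)) {a..b}"
  proof (rule has_integral_absolutely_continuous[OF \<open>a \<le> b\<close> _ \<open>negligible N\<close>])
    show "absolutely_continuous_on_interval g a b"
      using wd assms by (simp add: weakly_differentiable_on_nonneg_def)
    show "(g has_real_derivative g' s) (at s within {a..b})" if "s \<in> {a..b} - N" for s
      using that \<open>0 \<le> a\<close> by (intro has_field_derivative_subset[OF deriv]) (auto simp: N_def)
  qed
  have "(\<lambda>s. if s \<in> N then 0 else g' s) absolutely_integrable_on {a..b}"
    using int nonneg has_integral_spike[OF \<open>negligible N\<close>, of "{a..b}" "\<lambda>s. if s \<in> N then 0 else g' s" g']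
    by (intro nonnegative_absolutely_integrable_1) auto
  then show integrable: "set_integrable lebesgue {a..b} g'"
    by (rule absolutely_integrable_spike[OF _ \<open>negligible N\<close>]) auto
  show "(LINT s:{a..b}|lebesgue. g' s) = g b - g a"
    using set_lebesgue_integral_eq_integral(2)[OF integrable] int by (simp add: integral_unique)
  show "AE s in lebesgue. s \<in> {a..b} \<longrightarrow> 0 \<le> g' s"
    using nonneg \<open>negligible N\<close> unfolding eventually_ae_filter negligible_iff_null_sets
    by (intro bexI[of _ N]) auto
qed

section \<open>Monotone thresholds with decreasing weights\<close>

definition predecessor_in :: "real set \<Rightarrow> real \<Rightarrow> real" where
  "predecessor_in S s = Max {t \<in> S. t < s}"

lemma predecessor_in:
  assumes "finite S" "a \<in> S" "S \<subseteq> {a..b}" "s \<in> S - {a}"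
  shows "predecessor_in S s \<in> S" "predecessor_in S s < s" "a \<le> predecessor_in S s"
proof -
  have "a \<in> {t \<in> S. t < s}"
    using assms by (auto simp: less_le)
  then have "predecessor_in S s \<in> {t \<in> S. t < s}"
    unfolding predecessor_in_def using assms by (intro Max_in) auto
  then show "predecessor_in S s \<in> S" "predecessor_in S s < s" "a \<le> predecessor_in S s"
    using assms by auto
qed

lemma le_predecessor_in:
  assumes "finite S" "t \<in> S" "t < s"
  shows "t \<le> predecessor_in S s"
  using assms by (auto simp: predecessor_in_def intro!: Max_ge)

text \<open>
  On the interval from the predecessor of \<open>s\<close> to \<open>s\<close> the antitone weight \<open>h\<close> is at least
  \<open>h s\<close>, so each summand is at most the integral of \<open>g' h\<close> over that interval; these
  intervals are disjoint subsets of \<open>{a..b}\<close>.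
\<close>

lemma weighted_increments_le_integral:
  fixes g g' h :: "real \<Rightarrow> real"
  assumes wd: "weakly_differentiable_on_nonneg g g'"
    and mono: "mono_on {0..} g"
    and "0 \<le> a" "a \<le> b"
    and S: "finite S" "a \<in> S" "S \<subseteq> {a..b}"
    and h: "antimono_on {a..b} h" "\<And>s. s \<in> {a..b} \<Longrightarrow> 0 \<le> h s"
  shows "(\<Sum>s\<in>S - {a}. (g s - g (predecessor_in S s)) * h s) \<le>
    (LINT s:{a..b}|lebesgue. g' s * h s)"
proof -
  note pre = predecessor_in[OF S] and le_pre = le_predecessor_in[OF S(1)]
  \<comment> \<open>Half-open intervals, so that neighbours are disjoint.\<close>
  define J where "J s = {predecessor_in S s<..s}" for s
  have J_sub: "J s \<subseteq> {a..b}" if "s \<in> S - {a}" for s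
    using pre[OF that] that S by (auto simp: J_def)
  have disj: "disjoint_family_on J (S - {a})"
    unfolding disjoint_family_on_def
  proof (intro ballI impI)
    fix s t
    assume "s \<in> S - {a}" "t \<in> S - {a}" "s \<noteq> t"
    then have "s \<le> predecessor_in S t \<or> t \<le> predecessor_in S s"
      using le_pre by (metis DiffD1 linorder_neqE)
    then show "J s \<inter> J t = {}"
      by (auto simp: J_def)
  qed
  have "(\<lambda>x. - h x) \<in> borel_measurable (restrict_space borel {a..b})"
    using h(1) by (intro borel_measurable_mono_on_fnc) (auto simp: monotone_on_def)
  then have "h \<in> borel_measurable (restrict_space borel {a..b})"
    by simp
  then have "(\<lambda>x. indicator {a..b} x * h x) \<in> borel_measurable borel"
    by (subst (asm) borel_measurable_restrict_space_iff) simp_all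
  then have h_meas: "(\<lambda>x. indicator {a..b} x * h x) \<in> borel_measurable lebesgue"
    by (intro measurable_completion) simp
  note g' = weak_derivative_set_integrable[OF wd mono] weak_derivative_integral[OF wd mono]
    weak_derivative_nonneg[OF wd mono]
  have g'h: "set_integrable lebesgue {a..b} (\<lambda>s. g' s * h s)"
    unfolding set_integrable_def
  proof (rule Bochner_Integration.integrable_bound)
    show "integrable lebesgue (\<lambda>s. h a * (indicator {a..b} s *\<^sub>R g' s))"
      using g'(1)[OF \<open>0 \<le> a\<close> \<open>a \<le> b\<close>] by (simp add: set_integrable_def)
    have "(\<lambda>s. (indicator {a..b} s *\<^sub>R g' s) * (indicator {a..b} s * h s)) \<in> borel_measurable lebesgue"
      by (rule borel_measurable_times[OF borel_measurable_integrable h_meas])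
        (rule g'(1)[OF \<open>0 \<le> a\<close> \<open>a \<le> b\<close>, unfolded set_integrable_def])
    also have "(\<lambda>s. (indicator {a..b} s *\<^sub>R g' s) * (indicator {a..b} s * h s))
        = (\<lambda>s. indicator {a..b} s *\<^sub>R (g' s * h s))"
      by (auto simp: indicator_def)
    finally show "(\<lambda>s. indicator {a..b} s *\<^sub>R (g' s * h s)) \<in> borel_measurable lebesgue" .
    have "h s \<le> h a" if "s \<in> {a..b}" for s
      using that h(1) by (auto simp: monotone_on_def)
    then show "AE s in lebesgue. norm (indicator {a..b} s *\<^sub>R (g' s * h s))
        \<le> norm (h a * (indicator {a..b} s *\<^sub>R g' s))"
      using h(2) \<open>a \<le> b\<close>
      by (auto simp: indicator_def abs_mult mult.commute intro!: mult_right_mono AE_I2)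
  qed
  have "(\<Sum>s\<in>S - {a}. (g s - g (predecessor_in S s)) * h s) \<le> (\<Sum>s\<in>S - {a}. LINT t:J s|lebesgue. g' t * h t)"
  proof (rule sum_mono)
    fix s
    assume s: "s \<in> S - {a}"
    have sub: "{predecessor_in S s..s} \<subseteq> {a..b}" and "0 \<le> predecessor_in S s" "predecessor_in S s \<le> s"
      using pre[OF s] s S \<open>0 \<le> a\<close> by auto
    have int: "set_integrable lebesgue {predecessor_in S s..s} g'" "set_integrable lebesgue {predecessor_in S s..s} (\<lambda>t. g' t * h t)"
      using sub by (auto intro: set_integrable_subset[OF g'(1)[OF \<open>0 \<le> a\<close> \<open>a \<le> b\<close>]]
        set_integrable_subset[OF g'h])
    have "(g s - g (predecessor_in S s)) * h s = (LINT t:{predecessor_in S s..s}|lebesgue. g' t * h s)"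
      by (simp add: g'(2)[OF \<open>0 \<le> predecessor_in S s\<close> \<open>predecessor_in S s \<le> s\<close>])
    also have "\<dots> \<le> (LINT t:{predecessor_in S s..s}|lebesgue. g' t * h t)"
    proof (rule set_integral_mono_AE)
      show "AE t\<in>{predecessor_in S s..s} in lebesgue. g' t * h s \<le> g' t * h t"
        using g'(3)[OF \<open>0 \<le> predecessor_in S s\<close> \<open>predecessor_in S s \<le> s\<close>]
      proof eventually_elim
        case (elim t)
        then show ?case
          using sub h(1) s S by (auto simp: monotone_on_def subset_iff intro!: mult_left_mono)
      qed
    qed (use int in auto)
    also have "\<dots> = (LINT t:J s|lebesgue. g' t * h t)"
    proof (rule set_integral_cong_set)
      have "set_integrable lebesgue (J s) (\<lambda>t. g' t * h t)"
        by (rule set_integrable_subset[OF int(2)]) (auto simp: J_def)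
      then show "set_borel_measurable lebesgue (J s) (\<lambda>t. g' t * h t)"
        "set_borel_measurable lebesgue {predecessor_in S s..s} (\<lambda>t. g' t * h t)"
        using int(2) by (auto simp: set_integrable_def set_borel_measurable_def)
      have "AE t in lebesgue. t \<notin> {predecessor_in S s}"
        by (rule AE_not_in) (simp add: negligible_iff_null_sets[symmetric])
      then show "AE t in lebesgue. t \<in> J s \<longleftrightarrow> t \<in> {predecessor_in S s..s}"
        by eventually_elim (auto simp: J_def)
    qed
    finally show "(g s - g (predecessor_in S s)) * h s \<le> (LINT t:J s|lebesgue. g' t * h t)" .
  qed
  also have "\<dots> = (LINT t:(\<Union>s\<in>S - {a}. J s)|lebesgue. g' t * h t)"
    by (rule set_integral_finite_Union[OF _ disj, symmetric])
      (use S J_sub in \<open>auto intro!: set_integrable_subset[OF g'h] simp: J_def[abs_def]\<close>)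
  also have "\<dots> \<le> (LINT t:{a..b}|lebesgue. g' t * h t)"
    unfolding set_lebesgue_integral_def
  proof (rule integral_mono_AE')
    show "integrable lebesgue (\<lambda>s. indicator {a..b} s *\<^sub>R (g' s * h s))"
      using g'h by (simp add: set_integrable_def)
    show "AE s in lebesgue. 0 \<le> indicator {a..b} s *\<^sub>R (g' s * h s)"
      using g'(3)[OF \<open>0 \<le> a\<close> \<open>a \<le> b\<close>] by eventually_elim (use h in \<open>auto simp: indicator_def\<close>)
    show "AE s in lebesgue. indicator (\<Union>s\<in>S - {a}. J s) s *\<^sub>R (g' s * h s)
        \<le> indicator {a..b} s *\<^sub>R (g' s * h s)"
      using g'(3)[OF \<open>0 \<le> a\<close> \<open>a \<le> b\<close>]
    proof eventually_elim
      case (elim s)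
      have "(\<Union>s\<in>S - {a}. J s) \<subseteq> {a..b}"
        using J_sub by blast
      then show ?case
        using elim h(2)[of s] by (auto simp: indicator_def split: if_splits)
    qed
  qed
  finally show ?thesis .
qed

text \<open>
  The joint law of \<open>U\<close> and \<open>X\<close> is arbitrary, so the integrand is dominated by a function
  \<open>Z\<close> of \<open>U\<close> only: it is \<open>1\<close> for \<open>U \<le> g a\<close>, and \<open>h s\<close> when \<open>U\<close> lies between the values of
  \<open>g\<close> at the predecessor of \<open>s\<close> and at \<open>s\<close>.  If \<open>g a < U \<le> g X\<close>, then this \<open>s\<close>, the first point of \<open>S\<close>
  whose threshold reaches \<open>U\<close>, is at most \<open>X\<close>, and \<open>h X \<le> h s\<close>.
\<close>

lemma (in prob_space) expectation_weighted_threshold_le: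
  fixes U X :: "'a \<Rightarrow> real" and g g' h :: "real \<Rightarrow> real"
  assumes U: "random_variable borel U"
    and unif: "\<And>c. c \<in> {0..1} \<Longrightarrow> prob {\<omega> \<in> space M. U \<omega> \<le> c} = c"
    and wd: "weakly_differentiable_on_nonneg g g'"
    and mono: "mono_on {0..} g"
    and range: "\<And>s. 0 \<le> s \<Longrightarrow> g s \<in> {0..1}"
    and "0 \<le> a"
    and S: "finite S" "a \<in> S" "S \<subseteq> {a..b}"
    and X: "AE \<omega> in M. X \<omega> \<in> S"
    and h: "antimono_on {a..b} h" "\<And>s. s \<in> {a..b} \<Longrightarrow> h s \<in> {0..1}"
  shows "expectation (\<lambda>\<omega>. of_bool (U \<omega> \<le> g (X \<omega>)) * h (X \<omega>)) \<le>
    g a + (LINT s:{a..b}|lebesgue. g' s * h s)"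
proof -
  have "a \<le> b"
    using S by auto
  note pre = predecessor_in[OF S]
  have nonneg: "0 \<le> s" if "s \<in> S" for s
    using that S \<open>0 \<le> a\<close> by auto
  define below where "below c \<omega> = (of_bool (U \<omega> \<le> c) :: real)" for c \<omega>
  have below: "integrable M (below c)" "expectation (below c) = c" if "c \<in> {0..1}" for c
  proof -
    have eq: "below c \<omega> = indicator {\<omega> \<in> space M. U \<omega> \<le> c} \<omega>" if "\<omega> \<in> space M" for \<omega>
      using that by (auto simp: below_def)
    have ev: "{\<omega> \<in> space M. U \<omega> \<le> c} \<in> events"
      using U by measurable
    then show "integrable M (below c)"
      by (subst Bochner_Integration.integrable_cong[OF refl eq]) (auto simp: emeasure_eq_measure)
    show "expectation (below c) = c"
      using unif[OF that] ev by (subst Bochner_Integration.integral_cong[OF refl eq]) (auto simp: Int_absorb2)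
  qed
  define incr where "incr s \<omega> = (below (g s) \<omega> - below (g (predecessor_in S s)) \<omega>) * h s" for s \<omega>
  define Z where "Z \<omega> = below (g a) \<omega> + (\<Sum>s\<in>S - {a}. incr s \<omega>)" for \<omega>
  have increment_nonneg: "0 \<le> incr s \<omega>" if "s \<in> S - {a}" for s \<omega>
  proof -
    have "g (predecessor_in S s) \<le> g s"
      using pre[OF that] \<open>0 \<le> a\<close> by (intro mono_onD[OF mono]) auto
    then show ?thesis
      using h(2)[of s] that S by (auto simp: incr_def below_def)
  qed
  have dominated: "of_bool (U \<omega> \<le> g (X \<omega>)) * h (X \<omega>) \<le> Z \<omega>" if X: "X \<omega> \<in> S" for \<omega>
  proof -
    have sum_nonneg: "0 \<le> (\<Sum>s\<in>S - {a}. incr s \<omega>)"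
      using increment_nonneg by (rule sum_nonneg)
    have hX: "h (X \<omega>) \<in> {0..1}"
      using X S h by blast
    show ?thesis
    proof (cases "U \<omega> \<le> g a \<or> \<not> U \<omega> \<le> g (X \<omega>)")
      case True
      then show ?thesis
        using sum_nonneg hX by (auto simp: Z_def below_def)
    next
      case False
      define s where "s = Min {t \<in> S. U \<omega> \<le> g t}"
      have "s \<in> {t \<in> S. U \<omega> \<le> g t}"
        unfolding s_def using S X False by (intro Min_in) auto
      then have s: "s \<in> S - {a}" "U \<omega> \<le> g s"
        using False by auto
      have "s \<le> X \<omega>"
        unfolding s_def using S X False by (intro Min_le) auto
      then have "h (X \<omega>) \<le> h s"
        using h(1) X s S by (auto simp: monotone_on_def subset_iff)
      have "\<not> U \<omega> \<le> g (predecessor_in S s)"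
      proof
        assume "U \<omega> \<le> g (predecessor_in S s)"
        then have "s \<le> predecessor_in S s"
          unfolding s_def using pre(1)[OF s(1)] S by (intro Min_le) (auto simp: s_def)
        then show False
          using pre(2)[OF s(1)] by simp
      qed
      then have "h s = incr s \<omega>"
        using s by (simp add: incr_def below_def)
      also have "\<dots> \<le> (\<Sum>s\<in>S - {a}. incr s \<omega>)"
        by (rule member_le_sum[OF s(1)]) (use S increment_nonneg in auto)
      also have "\<dots> \<le> Z \<omega>"
        by (simp add: Z_def below_def)
      finally show ?thesis
        using \<open>h (X \<omega>) \<le> h s\<close> False by simp
    qed
  qed
  have g_range: "g a \<in> {0..1}" "\<And>s. s \<in> S - {a} \<Longrightarrow> g s \<in> {0..1}"
    "\<And>s. s \<in> S - {a} \<Longrightarrow> g (predecessor_in S s) \<in> {0..1}"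
    using range \<open>0 \<le> a\<close> nonneg pre by blast+
  have incr: "integrable M (incr s)" "expectation (incr s) = (g s - g (predecessor_in S s)) * h s"
    if "s \<in> S - {a}" for s
    unfolding incr_def using below g_range(2,3)[OF that] by auto
  have "integrable M Z"
    unfolding Z_def using below(1) g_range(1) incr(1)
    by (intro Bochner_Integration.integrable_add Bochner_Integration.integrable_sum) auto
  moreover have "0 \<le> Z \<omega>" for \<omega>
    using increment_nonneg by (auto simp: Z_def below_def intro!: add_nonneg_nonneg sum_nonneg)
  moreover have "AE \<omega> in M. of_bool (U \<omega> \<le> g (X \<omega>)) * h (X \<omega>) \<le> Z \<omega>"
    using X by eventually_elim (rule dominated)
  ultimately have "expectation (\<lambda>\<omega>. of_bool (U \<omega> \<le> g (X \<omega>)) * h (X \<omega>)) \<le> expectation Z"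
    by (intro integral_mono_AE') auto
  also have "\<dots> = g a + (\<Sum>s\<in>S - {a}. (g s - g (predecessor_in S s)) * h s)"
  proof -
    have "expectation (\<lambda>\<omega>. \<Sum>s\<in>S - {a}. incr s \<omega>) = (\<Sum>s\<in>S - {a}. expectation (incr s))"
      using incr(1) by (rule Bochner_Integration.integral_sum)
    moreover have "integrable M (\<lambda>\<omega>. \<Sum>s\<in>S - {a}. incr s \<omega>)"
      using incr(1) by (rule Bochner_Integration.integrable_sum)
    ultimately show ?thesis
      unfolding Z_def using below[OF g_range(1)] incr(2) by simp
  qed
  also have "\<dots> \<le> g a + (LINT s:{a..b}|lebesgue. g' s * h s)"
    using weighted_increments_le_integral[OF wd mono \<open>0 \<le> a\<close> \<open>a \<le> b\<close> S h(1)] h(2)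
    by simp
  finally show ?thesis .
qed

section \<open>Decisions and the false discovery proportion\<close>

lemma length_decisions [simp]: "length (decisions \<alpha> x k) = k"
  by (induction k) auto

lemma take_decisions: "k \<le> n \<Longrightarrow> take k (decisions \<alpha> x n) = decisions \<alpha> x k"
proof (induction n)
  case (Suc n)
  then show ?case
    by (cases "k = Suc n") auto
qed simp

lemma nth_decisions: "k < n \<Longrightarrow> decisions \<alpha> x n ! k \<longleftrightarrow> x (Suc k) \<le> \<alpha> (Suc k) (decisions \<alpha> x k)"
proof (induction n)
  case (Suc n)
  then show ?case
    by (cases "k = n") (auto simp: nth_append)
qed simp

lemma rejections_take_less:
  assumes "k < length r" "r ! k"
  shows "Suc (rejections (take k r)) \<le> rejections r"
proof -
  have "Suc (rejections (take k r)) = (\<Sum>j<Suc k. of_bool (r ! j))"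
    using assms by (simp add: rejections_def)
  also have "\<dots> \<le> rejections r"
    using assms unfolding rejections_def by (intro sum_mono2) auto
  finally show ?thesis .
qed

text \<open>
  This replaces the final number of rejections, which depends on all \<open>p\<close>-values, by a quantity
  known before the \<open>i\<close>-th test.
\<close>

lemma false_discovery_proportion_le:
  "real (false_rejections \<theta> r) / real (max (rejections r) 1) \<le>
    (\<Sum>i\<in>{i \<in> {1..length r}. \<theta> i = 0}. of_bool (r ! (i - 1)) * (1 / (real (rejections (take (i - 1) r)) + 1)))"
proof -
  have "real (false_rejections \<theta> r) / real (max (rejections r) 1)
      = (\<Sum>i\<in>{i \<in> {1..length r}. \<theta> i = 0}. of_bool (r ! (i - 1)) / real (max (rejections r) 1))"
    by (simp add: false_rejections_def sum_divide_distrib[symmetric] of_bool_def sum.If_cases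
        Int_def conj_ac)
  also have "\<dots> \<le> (\<Sum>i\<in>{i \<in> {1..length r}. \<theta> i = 0}.
      of_bool (r ! (i - 1)) * (1 / (real (rejections (take (i - 1) r)) + 1)))"
  proof (rule sum_mono)
    fix i
    assume "i \<in> {i \<in> {1..length r}. \<theta> i = 0}"
    then have "Suc (rejections (take (i - 1) r)) \<le> rejections r" if "r ! (i - 1)"
      using that by (intro rejections_take_less) auto
    then show "of_bool (r ! (i - 1)) / real (max (rejections r) 1)
        \<le> of_bool (r ! (i - 1)) * (1 / (real (rejections (take (i - 1) r)) + 1))"
      by (auto intro!: divide_left_mono)
  qed
  finally show ?thesis .
qed

section \<open>Reachable histories and null tests\<close>

context testing_model
begin

lemma parameters_nonempty: "parameters \<Theta> \<noteq> {}"
  using Theta_nonempty by (auto simp: parameters_def PiE_eq_empty_iff)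

lemma decisions_measurable:
  assumes "\<theta> \<in> parameters \<Theta>"
  shows "(\<lambda>\<omega>. decisions \<alpha> (\<lambda>i. p i \<omega>) k) \<in> P \<theta> \<rightarrow>\<^sub>M count_space UNIV"
proof (induction k)
  case (Suc k)
  have "(\<lambda>\<omega>. (\<lambda>r \<omega>. r @ [p (Suc k) \<omega> \<le> \<alpha> (Suc k) r]) (decisions \<alpha> (\<lambda>i. p i \<omega>) k) \<omega>)
      \<in> P \<theta> \<rightarrow>\<^sub>M count_space UNIV"
  proof (rule measurable_compose_countable[OF _ Suc])
    fix r
    have "p (Suc k) \<in> borel_measurable (P \<theta>)"
      by (rule pvalue_measurable[OF assms]) simp
    then have "Measurable.pred (P \<theta>) (\<lambda>\<omega>. p (Suc k) \<omega> \<le> \<alpha> (Suc k) r)"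
      by measurable
    then show "(\<lambda>\<omega>. r @ [p (Suc k) \<omega> \<le> \<alpha> (Suc k) r]) \<in> P \<theta> \<rightarrow>\<^sub>M count_space UNIV"
      by (rule measurable_compose) simp
  qed
  then show ?case
    by simp
qed simp

lemma finite_reachable: "finite (reachable \<Theta> P p \<alpha> k)"
proof (rule finite_subset)
  show "reachable \<Theta> P p \<alpha> k \<subseteq> {r. set r \<subseteq> UNIV \<and> length r = k}"
    by (auto simp: reachable_def)
qed (rule finite_lists_length_eq, simp)

text \<open>
  Only finitely many histories of a given length are excluded, each with probability zero under
  every parameter.
\<close>

lemma AE_decisions_reachable:
  assumes \<theta>: "\<theta> \<in> parameters \<Theta>"
  shows "AE \<omega> in P \<theta>. decisions \<alpha> (\<lambda>i. p i \<omega>) k \<in> reachable \<Theta> P p \<alpha> k"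
proof -
  interpret prob_space "P \<theta>"
    by (rule prob_space[OF \<theta>])
  let ?D = "\<lambda>\<omega>. decisions \<alpha> (\<lambda>i. p i \<omega>) k"
  let ?L = "{r. set r \<subseteq> (UNIV :: bool set) \<and> length r = k}"
  have "AE \<omega> in P \<theta>. \<forall>r\<in>?L - reachable \<Theta> P p \<alpha> k. ?D \<omega> \<noteq> r"
  proof (rule AE_finite_allI)
    show "finite (?L - reachable \<Theta> P p \<alpha> k)"
      by (intro finite_Diff finite_lists_length_eq) simp
    fix r
    assume "r \<in> ?L - reachable \<Theta> P p \<alpha> k"
    then have "prob {\<omega> \<in> space (P \<theta>). ?D \<omega> = r} = 0"
      using \<theta> by (auto simp: reachable_def zero_less_measure_iff)
    moreover have "{\<omega> \<in> space (P \<theta>). ?D \<omega> = r} \<in> events"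
      using measurable_sets[OF decisions_measurable[OF \<theta>], of "{r}" \<alpha> k]
      by (simp add: vimage_def Int_def conj_commute)
    ultimately have "AE \<omega> in P \<theta>. \<omega> \<notin> {\<omega> \<in> space (P \<theta>). ?D \<omega> = r}"
      by (simp only: prob_eq_0)
    then show "AE \<omega> in P \<theta>. ?D \<omega> \<noteq> r"
      using AE_space by eventually_elim simp
  qed
  then show ?thesis
    by eventually_elim auto
qed

lemma reachable_nonempty: "reachable \<Theta> P p \<alpha> k \<noteq> {}"
proof
  assume empty: "reachable \<Theta> P p \<alpha> k = {}"
  obtain \<theta> where \<theta>: "\<theta> \<in> parameters \<Theta>"
    using parameters_nonempty by blast
  interpret prob_space "P \<theta>"
    by (rule prob_space[OF \<theta>])
  show False
    using AE_decisions_reachable[OF \<theta>, of \<alpha> k] empty by simp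
qed

lemma reachable_index_values:
  fixes \<alpha> \<I> :: "nat \<Rightarrow> bool list \<Rightarrow> real"
  defines "\<R> \<equiv> reachable \<Theta> P p \<alpha>"
  shows "finite (\<I> k ` \<R> k)"
    and "I_min \<R> \<I> k \<in> \<I> k ` \<R> k"
    and "I_max \<R> \<I> k \<in> \<I> k ` \<R> k"
    and "\<I> k ` \<R> k \<subseteq> {I_min \<R> \<I> k..I_max \<R> \<I> k}"
proof -
  show fin: "finite (\<I> k ` \<R> k)"
    by (simp add: \<R>_def finite_reachable)
  have "\<I> k ` \<R> k \<noteq> {}"
    by (simp add: \<R>_def reachable_nonempty)
  with fin show "I_min \<R> \<I> k \<in> \<I> k ` \<R> k" "I_max \<R> \<I> k \<in> \<I> k ` \<R> k"
    unfolding I_min_def I_max_def by (auto intro: Min_in Max_in)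
  show "\<I> k ` \<R> k \<subseteq> {I_min \<R> \<I> k..I_max \<R> \<I> k}"
    using fin unfolding I_min_def I_max_def by (auto intro!: Min_le Max_ge)
qed

lemma prob_null_pvalue_le:
  assumes \<theta>: "\<theta> \<in> parameters \<Theta>" and i: "i \<ge> 1" "\<theta> i = 0" and c: "c \<in> {0..1}"
  shows "measure (P \<theta>) {\<omega> \<in> space (P \<theta>). p i \<omega> \<le> c} = c"
proof -
  have "measure (P \<theta>) {\<omega> \<in> space (P \<theta>). p i \<omega> \<le> c} = measure (distr (P \<theta>) borel (p i)) {..c}"
    using pvalue_measurable[OF \<theta> i(1)]
    by (subst measure_distr) (auto intro!: arg_cong[where f = "measure (P \<theta>)"])
  also have "\<dots> = measure lborel ({0..1} \<inter> {..c}) / measure lborel {0..1::real}"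
    unfolding null_uniform[OF \<theta> i] by (rule measure_uniform_measure) auto
  also have "{0..1} \<inter> {..c} = {0..c}"
    using c by auto
  finally show ?thesis
    using c by simp
qed

text \<open>
  The threshold bound applied with the index value as \<open>X\<close>: a reachable history with index value
  \<open>x\<close> is one of the histories over which \<open>R_L\<close> at \<open>x\<close> is a minimum, and this minimum runs over
  fewer histories as \<open>x\<close> grows, so the weight decreases.
\<close>

lemma expectation_rejection_share_le:
  assumes \<theta>: "\<theta> \<in> parameters \<Theta>" and i: "i \<ge> 1" "\<theta> i = 0"
    and index_nonneg: "\<And>r. length r = i - 1 \<Longrightarrow> 0 \<le> \<I> (i - 1) r"
    and alpha_eq: "\<And>r. length r = i - 1 \<Longrightarrow> \<alpha> i r = g (\<I> (i - 1) r)"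
    and g_range: "\<And>s. 0 \<le> s \<Longrightarrow> g s \<in> {0..1}"
    and mono: "mono_on {0..} g"
    and wd: "weakly_differentiable_on_nonneg g g'"
  defines "\<R> \<equiv> reachable \<Theta> P p \<alpha>"
    and "D \<equiv> \<lambda>\<omega>. decisions \<alpha> (\<lambda>i. p i \<omega>) (i - 1)"
  shows "(LINT \<omega>|P \<theta>. of_bool (p i \<omega> \<le> \<alpha> i (D \<omega>)) * (1 / (real (rejections (D \<omega>)) + 1))) \<le>
    g (I_min \<R> \<I> (i - 1)) + (LINT s:{I_min \<R> \<I> (i - 1)..I_max \<R> \<I> (i - 1)}|lebesgue.
      g' s / (real (R_L \<R> \<I> i s) + 1))"
proof -
  interpret prob_space "P \<theta>"
    by (rule prob_space[OF \<theta>])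
  define S where "S = \<I> (i - 1) ` \<R> (i - 1)"
  define a where "a = I_min \<R> \<I> (i - 1)"
  define b where "b = I_max \<R> \<I> (i - 1)"
  define h where "h s = 1 / (real (R_L \<R> \<I> i s) + 1)" for s
  have "finite S" "a \<in> S" "b \<in> S" "S \<subseteq> {a..b}"
    unfolding S_def a_def b_def \<R>_def by (rule reachable_index_values)+
  have length: "length r = i - 1" if "r \<in> \<R> (i - 1)" for r
    using that by (simp add: \<R>_def reachable_def)
  have "0 \<le> a"
    using \<open>a \<in> S\<close> index_nonneg length by (auto simp: S_def)
  \<comment> \<open>Beyond \<open>b\<close> no history is left and the value of \<open>R_L\<close> is unspecified.\<close>
  have R_L_mono: "R_L \<R> \<I> i s \<le> R_L \<R> \<I> i t" if "s \<le> t" "t \<le> b" for s t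
    unfolding R_L_def
  proof (rule Min_antimono)
    show "rejections ` {r \<in> \<R> (i - 1). t \<le> \<I> (i - 1) r} \<noteq> {}"
      using \<open>b \<in> S\<close> that by (auto simp: S_def)
  qed (use that in \<open>auto simp: \<R>_def finite_reachable\<close>)
  have AE_D: "AE \<omega> in P \<theta>. D \<omega> \<in> \<R> (i - 1)"
    unfolding D_def \<R>_def by (rule AE_decisions_reachable[OF \<theta>])
  have "(LINT \<omega>|P \<theta>. of_bool (p i \<omega> \<le> \<alpha> i (D \<omega>)) * (1 / (real (rejections (D \<omega>)) + 1)))
      \<le> (LINT \<omega>|P \<theta>. of_bool (p i \<omega> \<le> g (\<I> (i - 1) (D \<omega>))) * h (\<I> (i - 1) (D \<omega>)))"
  proof (rule integral_mono_AE')
    have D_meas: "D \<in> P \<theta> \<rightarrow>\<^sub>M count_space UNIV"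
      unfolding D_def by (rule decisions_measurable[OF \<theta>])
    have [measurable]: "p i \<in> borel_measurable (P \<theta>)"
      by (rule pvalue_measurable[OF \<theta> i(1)])
    have [measurable]: "(\<lambda>\<omega>. f (D \<omega>)) \<in> borel_measurable (P \<theta>)" for f :: "bool list \<Rightarrow> real"
      by (rule measurable_compose[OF D_meas]) simp
    show "integrable (P \<theta>) (\<lambda>\<omega>. of_bool (p i \<omega> \<le> g (\<I> (i - 1) (D \<omega>))) * h (\<I> (i - 1) (D \<omega>)))"
    proof (rule integrable_const_bound[where B = 1])
      show "(\<lambda>\<omega>. of_bool (p i \<omega> \<le> g (\<I> (i - 1) (D \<omega>))) * h (\<I> (i - 1) (D \<omega>))) \<in> borel_measurable (P \<theta>)"
        by measurable
    qed (simp add: h_def)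
    show "AE \<omega> in P \<theta>. of_bool (p i \<omega> \<le> \<alpha> i (D \<omega>)) * (1 / (real (rejections (D \<omega>)) + 1))
        \<le> of_bool (p i \<omega> \<le> g (\<I> (i - 1) (D \<omega>))) * h (\<I> (i - 1) (D \<omega>))"
      using AE_D
    proof eventually_elim
      case (elim \<omega>)
      have "R_L \<R> \<I> i (\<I> (i - 1) (D \<omega>)) \<le> rejections (D \<omega>)"
        unfolding R_L_def using elim by (intro Min_le) (auto simp: \<R>_def finite_reachable)
      then show ?case
        using alpha_eq[OF length[OF elim]] by (auto simp: h_def intro!: divide_left_mono)
    qed
    show "AE \<omega> in P \<theta>. 0 \<le> of_bool (p i \<omega> \<le> g (\<I> (i - 1) (D \<omega>))) * h (\<I> (i - 1) (D \<omega>))"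
      by (simp add: h_def)
  qed
  also have "\<dots> \<le> g a + (LINT s:{a..b}|lebesgue. g' s * h s)"
  proof (rule expectation_weighted_threshold_le[OF _ _ wd mono g_range \<open>0 \<le> a\<close>
        \<open>finite S\<close> \<open>a \<in> S\<close> \<open>S \<subseteq> {a..b}\<close>])
    show "random_variable borel (p i)"
      by (rule pvalue_measurable[OF \<theta> i(1)])
    show "prob {\<omega> \<in> space (P \<theta>). p i \<omega> \<le> c} = c" if "c \<in> {0..1}" for c
      by (rule prob_null_pvalue_le[OF \<theta> i that])
    show "AE \<omega> in P \<theta>. \<I> (i - 1) (D \<omega>) \<in> S"
      using AE_D by eventually_elim (simp add: S_def)
    show "antimono_on {a..b} h"
      using R_L_mono by (auto simp: monotone_on_def h_def intro!: divide_left_mono)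
    show "h s \<in> {0..1}" for s
      by (simp add: h_def)
  qed
  finally show ?thesis
    by (simp add: a_def b_def h_def)
qed

end

section \<open>The false discovery rate bound\<close>

theorem theorem3p7:
  fixes \<Theta> :: "'t::zero set"
    and P :: "(nat \<Rightarrow> 't) \<Rightarrow> 'w measure"
    and p :: "nat \<Rightarrow> 'w \<Rightarrow> real"
    and w\<^sub>0 b\<^sub>0 :: real
    and \<alpha> \<phi> \<psi> :: "nat \<Rightarrow> bool list \<Rightarrow> real"
    and \<I> :: "nat \<Rightarrow> bool list \<Rightarrow> real"
    and g g' :: "nat \<Rightarrow> real \<Rightarrow> real"
    and n :: nat
  defines "\<R> \<equiv> reachable \<Theta> P p \<alpha>"
  assumes model: "testing_model \<Theta> P p"
    and rule: "generalized_alpha_investing w\<^sub>0 b\<^sub>0 \<alpha> \<phi> \<psi>"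
    and index_nonneg: "\<And>i r. length r = i \<Longrightarrow> \<I> i r \<ge> 0"
    and g_range: "\<And>j s. j \<ge> 1 \<Longrightarrow> s \<ge> 0 \<Longrightarrow> g j s \<in> {0..1}"
    and alpha_eq: "\<And>j r. j \<ge> 1 \<Longrightarrow> length r = j - 1 \<Longrightarrow> \<alpha> j r = g j (\<I> (j - 1) r)"
    and g_mono: "\<And>j. j \<ge> 1 \<Longrightarrow> mono_on {0..} (g j)"
    and g_weak_deriv: "\<And>j. j \<ge> 1 \<Longrightarrow> weakly_differentiable_on_nonneg (g j) (g' j)"
    and "n \<ge> 1"
  shows "FDR \<Theta> P p \<alpha> n \<le>
    (\<Sum>i=1..n. g i (I_min \<R> \<I> (i - 1)) +
       (LINT s:{I_min \<R> \<I> (i - 1)..I_max \<R> \<I> (i - 1)}|lebesgue.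
          g' i s / (real (R_L \<R> \<I> i s) + 1)))"
proof -
  interpret testing_model \<Theta> P p
    by (rule model)
  define B where "B i = g i (I_min \<R> \<I> (i - 1)) +
       (LINT s:{I_min \<R> \<I> (i - 1)..I_max \<R> \<I> (i - 1)}|lebesgue.
          g' i s / (real (R_L \<R> \<I> i s) + 1))" for i
  \<comment> \<open>The bound also counts the false nulls, whose summands must therefore be nonnegative.\<close>
  have B_nonneg: "0 \<le> B i" if "i \<ge> 1" for i
  proof -
    have I_min: "I_min \<R> \<I> (i - 1) \<in> \<I> (i - 1) ` \<R> (i - 1)"
      unfolding \<R>_def by (rule reachable_index_values)
    then obtain r where "length r = i - 1" "I_min \<R> \<I> (i - 1) = \<I> (i - 1) r"
      by (auto simp: \<R>_def reachable_def)
    then have "0 \<le> I_min \<R> \<I> (i - 1)"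
      using index_nonneg[of r "i - 1"] by simp
    moreover have "I_min \<R> \<I> (i - 1) \<le> I_max \<R> \<I> (i - 1)"
      using I_min reachable_index_values(4)[where \<I> = \<I> and k = "i - 1" and \<alpha> = \<alpha>] by (auto simp: \<R>_def)
    ultimately have "g i (I_min \<R> \<I> (i - 1)) \<in> {0..1}"
      and "AE s in lebesgue. s \<in> {I_min \<R> \<I> (i - 1)..I_max \<R> \<I> (i - 1)} \<longrightarrow> 0 \<le> g' i s"
      using g_range weak_derivative_nonneg[OF g_weak_deriv g_mono] \<open>i \<ge> 1\<close> by blast+
    moreover from this(2) have "0 \<le> (LINT s:{I_min \<R> \<I> (i - 1)..I_max \<R> \<I> (i - 1)}|lebesgue.
          g' i s / (real (R_L \<R> \<I> i s) + 1))"
      unfolding set_lebesgue_integral_def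
      by (intro integral_nonneg_AE) (auto elim!: eventually_mono simp: indicator_def)
    ultimately show ?thesis
      by (simp add: B_def)
  qed
  have "(LINT \<omega>|P \<theta>. (let r = decisions \<alpha> (\<lambda>i. p i \<omega>) n
      in real (false_rejections \<theta> r) / real (max (rejections r) 1))) \<le> (\<Sum>i=1..n. B i)"
    if \<theta>: "\<theta> \<in> parameters \<Theta>" for \<theta>
  proof -
    interpret prob_space "P \<theta>"
      by (rule prob_space[OF \<theta>])
    define D where "D k \<omega> = decisions \<alpha> (\<lambda>i. p i \<omega>) k" for k \<omega>
    define share where "share i \<omega> =
      of_bool (p i \<omega> \<le> \<alpha> i (D (i - 1) \<omega>)) * (1 / (real (rejections (D (i - 1) \<omega>)) + 1))" for i \<omega>
    define I\<^sub>0 where "I\<^sub>0 = {i \<in> {1..n}. \<theta> i = 0}"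
    have share_integrable: "integrable (P \<theta>) (share i)" if "i \<in> I\<^sub>0" for i
    proof (rule integrable_const_bound[where B = 1])
      have D_meas: "D (i - 1) \<in> P \<theta> \<rightarrow>\<^sub>M count_space UNIV"
        unfolding D_def by (rule decisions_measurable[OF \<theta>])
      have [measurable]: "p i \<in> borel_measurable (P \<theta>)"
        using that by (intro pvalue_measurable[OF \<theta>]) (simp add: I\<^sub>0_def)
      have [measurable]: "(\<lambda>\<omega>. f (D (i - 1) \<omega>)) \<in> borel_measurable (P \<theta>)" for f :: "bool list \<Rightarrow> real"
        by (rule measurable_compose[OF D_meas]) simp
      show "share i \<in> borel_measurable (P \<theta>)"
        unfolding share_def by measurable
    qed (simp add: share_def)
    have "(LINT \<omega>|P \<theta>. (let r = decisions \<alpha> (\<lambda>i. p i \<omega>) n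
        in real (false_rejections \<theta> r) / real (max (rejections r) 1)))
        \<le> (LINT \<omega>|P \<theta>. (\<Sum>i\<in>I\<^sub>0. share i \<omega>))"
    proof (rule integral_mono')
      show "integrable (P \<theta>) (\<lambda>\<omega>. \<Sum>i\<in>I\<^sub>0. share i \<omega>)"
        using share_integrable by (rule Bochner_Integration.integrable_sum)
      show "0 \<le> (\<Sum>i\<in>I\<^sub>0. share i \<omega>)" for \<omega>
        by (intro sum_nonneg) (simp add: share_def)
      fix \<omega>
      have "real (false_rejections \<theta> (D n \<omega>)) / real (max (rejections (D n \<omega>)) 1)
          \<le> (\<Sum>i\<in>I\<^sub>0. of_bool (D n \<omega> ! (i - 1)) * (1 / (real (rejections (take (i - 1) (D n \<omega>))) + 1)))"
        using false_discovery_proportion_le[of \<theta> "D n \<omega>"] by (simp add: I\<^sub>0_def D_def)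
      also have "\<dots> = (\<Sum>i\<in>I\<^sub>0. share i \<omega>)"
      proof (rule sum.cong[OF refl])
        fix i
        assume "i \<in> I\<^sub>0"
        then have "i - 1 < n" "Suc (i - 1) = i"
          by (auto simp: I\<^sub>0_def)
        then show "of_bool (D n \<omega> ! (i - 1)) * (1 / (real (rejections (take (i - 1) (D n \<omega>))) + 1)) = share i \<omega>"
          by (simp only: share_def D_def nth_decisions take_decisions less_imp_le)
      qed
      finally show "(let r = decisions \<alpha> (\<lambda>i. p i \<omega>) n
          in real (false_rejections \<theta> r) / real (max (rejections r) 1)) \<le> (\<Sum>i\<in>I\<^sub>0. share i \<omega>)"
        by (simp add: D_def Let_def)
    qed
    also have "\<dots> = (\<Sum>i\<in>I\<^sub>0. LINT \<omega>|P \<theta>. share i \<omega>)"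
      using share_integrable by (rule Bochner_Integration.integral_sum)
    also have "\<dots> \<le> (\<Sum>i\<in>I\<^sub>0. B i)"
    proof (rule sum_mono)
      fix i
      assume "i \<in> I\<^sub>0"
      then have i: "i \<ge> 1" "\<theta> i = 0"
        by (auto simp: I\<^sub>0_def)
      show "(LINT \<omega>|P \<theta>. share i \<omega>) \<le> B i"
        unfolding share_def D_def B_def \<R>_def
        by (rule expectation_rejection_share_le[where \<I> = \<I> and \<alpha> = \<alpha> and g = "g i", OF \<theta> i index_nonneg
              alpha_eq[OF i(1)]
              g_range[OF i(1)] g_mono[OF i(1)] g_weak_deriv[OF i(1)]])
    qed
    also have "\<dots> \<le> (\<Sum>i=1..n. B i)"
      by (rule sum_mono2) (auto simp: I\<^sub>0_def B_nonneg)
    finally show ?thesis .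
  qed
  then show ?thesis
    unfolding FDR_def B_def by (intro cSUP_least parameters_nonempty)
qed

end
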